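(* Let $R = R_0[x_1,\ldots,x_d]$ be a commutative Noetherian standard graded algebra, i.e. $R$ is $\mathbb{N}$-graded with degree-$0$ component $R_0$ and $\deg(x_i)=1$ for $1\le i\le d$. Let $M$ be a finitely generated $\mathbb{Z}$-graded $R$-module. Denote $R_+:=\bigoplus_{n\ge 1}R_n$. If $\mathfrak{p}\in\mathrm{Ass}_R(M)$ is such that $R_+\subseteq\mathfrak{p}$, then $v_{\mathfrak{p}}(M)\le\mathrm{reg}(M)$. In particular, if $\mathrm{depth}(R_+,M)=0$, then $v(M)\le\mathrm{reg}(M)$.
   Context: For $\mathfrak{p}\in\mathrm{Ass}_R(M)$, the v-number of $M$ at $\mathfrak{p}$ is $v_{\mathfrak{p}}(M) := \inf\{ u : \text{there exists } x\in M_u \text{ such that } \mathfrak{p} = (0:_R x)\}$, and the v-number of $M$ is $v(M) := \inf\{v_{\mathfrak{p}}(M) : \mathfrak{p}\in\mathrm{Ass}_R(M)\}$, with $v(0)=\infty$. For a graded module $L$, $\mathrm{end}(L):=\sup\{n:L_n\ne0\}$, with $\mathrm{end}(0)=-\infty$. The Castelnuovo-Mumford regularity of $M$ is $$\mathrm{reg}(M) := \max\{ \mathrm{end}\big( H_{R_+}^i(M)\big) + i : 0\le i \le \dim(R) \},$$ where $H_{R_+}^i(M)$ is the $i$th local cohomology module of $M$ with respect to $R_+$. $\mathrm{depth}(R_+,M)$ is the length of a maximal $M$-regular sequence contained in $R_+$ (with the standard convention that it is $\infty$ if $R_+M=M$, in particular if $M=0$). *)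

theory Defs
  imports "HOL-Library.Extended_Real" "HOL-Library.Extended_Nat" "HOL-Algebra.Algebra"
begin

section \<open>Graded rings and modules\<close>

record 'a graded_ring = "'a ring" +
  rcomp :: "nat \<Rightarrow> 'a set"

record ('a, 'b) graded_module = "('a, 'b) module" +
  mcomp :: "int \<Rightarrow> 'b set"

text \<open>The abelian group underlying \<open>G\<close> is the internal direct sum of the family \<open>A\<close>.\<close>

definition internal_direct_sum :: "('b, 'z) ring_scheme \<Rightarrow> ('i \<Rightarrow> 'b set) \<Rightarrow> bool" where
  "internal_direct_sum G A \<longleftrightarrow>
     (\<forall>n. additive_subgroup (A n) G) \<and>
     (\<forall>x\<in>carrier G. \<exists>!f. (\<forall>n. f n \<in> A n) \<and> finite {n. f n \<noteq> \<zero>\<^bsub>G\<^esub>} \<and>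
        x = (\<Oplus>\<^bsub>G\<^esub>n\<in>{n. f n \<noteq> \<zero>\<^bsub>G\<^esub>}. f n))"

definition graded_ring :: "'a graded_ring \<Rightarrow> bool" where
  "graded_ring R \<longleftrightarrow> cring R \<and> internal_direct_sum R (rcomp R) \<and>
     (\<forall>m n. \<forall>a\<in>rcomp R m. \<forall>b\<in>rcomp R n. a \<otimes>\<^bsub>R\<^esub> b \<in> rcomp R (m + n))"

definition standard_graded :: "'a graded_ring \<Rightarrow> nat \<Rightarrow> (nat \<Rightarrow> 'a) \<Rightarrow> bool" where
  "standard_graded R d x \<longleftrightarrow> graded_ring R \<and> (\<forall>i\<in>{1..d}. x i \<in> rcomp R 1) \<and>
     generate_ring R (rcomp R 0 \<union> x ` {1..d}) = carrier R"

definition irrelevant :: "'a graded_ring \<Rightarrow> 'a set" where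
  "irrelevant R = {r. \<exists>f N. (\<forall>n. f n \<in> rcomp R n) \<and> r = (\<Oplus>\<^bsub>R\<^esub>n\<in>{1..N::nat}. f n)}"

definition graded_module :: "'a graded_ring \<Rightarrow> ('a, 'b) graded_module \<Rightarrow> bool" where
  "graded_module R M \<longleftrightarrow> module R M \<and> internal_direct_sum M (mcomp M) \<and>
     (\<forall>n u. \<forall>a\<in>rcomp R n. \<forall>y\<in>mcomp M u. a \<odot>\<^bsub>M\<^esub> y \<in> mcomp M (int n + u))"

definition graded_hom ::
    "'a graded_ring \<Rightarrow> ('a, 'b) graded_module \<Rightarrow> ('a, 'c) graded_module \<Rightarrow> ('b \<Rightarrow> 'c) set" where
  "graded_hom R M N = {f. f \<in> carrier M \<rightarrow> carrier N \<and>
     (\<forall>y\<in>carrier M. \<forall>z\<in>carrier M. f (y \<oplus>\<^bsub>M\<^esub> z) = f y \<oplus>\<^bsub>N\<^esub> f z) \<and>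
     (\<forall>a\<in>carrier R. \<forall>y\<in>carrier M. f (a \<odot>\<^bsub>M\<^esub> y) = a \<odot>\<^bsub>N\<^esub> f y) \<and>
     (\<forall>u. \<forall>y\<in>mcomp M u. f y \<in> mcomp N u)}"

definition submodule_span :: "'a graded_ring \<Rightarrow> ('a, 'b) graded_module \<Rightarrow> 'b set \<Rightarrow> 'b set" where
  "submodule_span R M S = \<Inter>{N. submodule N R M \<and> S \<subseteq> N}"

definition finitely_generated :: "'a graded_ring \<Rightarrow> ('a, 'b) graded_module \<Rightarrow> bool" where
  "finitely_generated R M \<longleftrightarrow>
     (\<exists>S. finite S \<and> S \<subseteq> carrier M \<and> submodule_span R M S = carrier M)"


section \<open>Associated primes and v-numbers\<close>

definition annihilator :: "'a graded_ring \<Rightarrow> ('a, 'b) graded_module \<Rightarrow> 'b \<Rightarrow> 'a set" where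
  "annihilator R M y = {a \<in> carrier R. a \<odot>\<^bsub>M\<^esub> y = \<zero>\<^bsub>M\<^esub>}"

definition Ass :: "'a graded_ring \<Rightarrow> ('a, 'b) graded_module \<Rightarrow> 'a set set" where
  "Ass R M = {p. primeideal p R \<and> (\<exists>y\<in>carrier M. p = annihilator R M y)}"

definition v_number_at :: "'a graded_ring \<Rightarrow> ('a, 'b) graded_module \<Rightarrow> 'a set \<Rightarrow> ereal" where
  "v_number_at R M p = Inf {ereal (of_int u) |u. \<exists>y\<in>mcomp M u. p = annihilator R M y}"

text \<open>If \<open>M = 0\<close> there are no associated primes and the infimum is \<open>\<infinity>\<close>.\<close>

definition v_number :: "'a graded_ring \<Rightarrow> ('a, 'b) graded_module \<Rightarrow> ereal" where
  "v_number R M = Inf (v_number_at R M ` Ass R M)"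


section \<open>Depth\<close>

text \<open>For a subset \<open>I\<close> of \<open>R\<close>, the submodule \<open>IM\<close>; it depends only on the ideal generated by \<open>I\<close>.\<close>

definition ideal_smult :: "'a graded_ring \<Rightarrow> ('a, 'b) graded_module \<Rightarrow> 'a set \<Rightarrow> 'b set" where
  "ideal_smult R M I = submodule_span R M {a \<odot>\<^bsub>M\<^esub> y |a y. a \<in> I \<and> y \<in> carrier M}"

text \<open>The middle condition says that \<open>xs ! i\<close> is a nonzerodivisor on the quotient of \<open>M\<close> by
  \<open>(xs ! 0, \<dots>, xs ! (i - 1))M\<close>.\<close>

definition regular_sequence :: "'a graded_ring \<Rightarrow> ('a, 'b) graded_module \<Rightarrow> 'a list \<Rightarrow> bool" where
  "regular_sequence R M xs \<longleftrightarrow> set xs \<subseteq> carrier R \<and>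
     (\<forall>i<length xs. \<forall>y\<in>carrier M.
        (xs ! i) \<odot>\<^bsub>M\<^esub> y \<in> ideal_smult R M (set (take i xs)) \<longrightarrow>
        y \<in> ideal_smult R M (set (take i xs))) \<and>
     ideal_smult R M (set xs) \<noteq> carrier M"

definition maximal_regular_sequence ::
    "'a graded_ring \<Rightarrow> ('a, 'b) graded_module \<Rightarrow> 'a set \<Rightarrow> 'a list \<Rightarrow> bool" where
  "maximal_regular_sequence R M I xs \<longleftrightarrow> set xs \<subseteq> I \<and> regular_sequence R M xs \<and>
     (\<forall>a\<in>I. \<not> regular_sequence R M (xs @ [a]))"

text \<open>For \<open>R\<close> Noetherian, \<open>M\<close> finitely generated and \<open>IM \<noteq> M\<close>, maximal \<open>M\<close>-regular sequences
  in \<open>I\<close> exist and all have the same length, so the choice below is immaterial.\<close>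

definition depth :: "'a graded_ring \<Rightarrow> 'a set \<Rightarrow> ('a, 'b) graded_module \<Rightarrow> enat" where
  "depth R I M = (if ideal_smult R M I = carrier M then \<infinity>
     else enat (length (SOME xs. maximal_regular_sequence R M I xs)))"


section \<open>Graded injective resolutions\<close>

text \<open>Injective objects of the category of graded modules and degree-preserving homomorphisms.
  A formula cannot quantify over types, so the test modules \<open>B\<close>, \<open>C\<close> are carried by the type of
  ring elements. This is no restriction: this type carries all shifts of \<open>R\<close> and of its
  homogeneous ideals, and by the graded Baer criterion the extension property for the inclusions
  between these implies it for arbitrary graded modules.\<close>

definition graded_injective :: "'a graded_ring \<Rightarrow> ('a, 'e) graded_module \<Rightarrow> bool" where
  "graded_injective R E \<longleftrightarrow> graded_module R E \<and>
     (\<forall>(B :: ('a, 'a) graded_module) (C :: ('a, 'a) graded_module) j f.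
        graded_module R B \<and> graded_module R C \<and>
        j \<in> graded_hom R B C \<and> inj_on j (carrier B) \<and> f \<in> graded_hom R B E \<longrightarrow>
        (\<exists>g\<in>graded_hom R C E. \<forall>b\<in>carrier B. g (j b) = f b))"

text \<open>Exactness of \<open>0 \<rightarrow> M \<rightarrow> E 0 \<rightarrow> E 1 \<rightarrow> \<dots>\<close>, with augmentation \<open>\<eta>\<close>, differentials \<open>\<delta>\<close> and all
  \<open>E i\<close> injective.\<close>

definition graded_injective_resolution ::
    "'a graded_ring \<Rightarrow> ('a, 'b) graded_module \<Rightarrow> (nat \<Rightarrow> ('a, 'e) graded_module) \<Rightarrow>
     (nat \<Rightarrow> 'e \<Rightarrow> 'e) \<Rightarrow> ('b \<Rightarrow> 'e) \<Rightarrow> bool" where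
  "graded_injective_resolution R M E \<delta> \<eta> \<longleftrightarrow>
     (\<forall>i. graded_injective R (E i)) \<and>
     \<eta> \<in> graded_hom R M (E 0) \<and> (\<forall>i. \<delta> i \<in> graded_hom R (E i) (E (Suc i))) \<and>
     inj_on \<eta> (carrier M) \<and>
     \<eta> ` carrier M = {e \<in> carrier (E 0). \<delta> 0 e = \<zero>\<^bsub>E 1\<^esub>} \<and>
     (\<forall>i. \<delta> i ` carrier (E i) = {e \<in> carrier (E (Suc i)). \<delta> (Suc i) e = \<zero>\<^bsub>E (Suc (Suc i))\<^esub>})"


section \<open>Local cohomology and regularity\<close>

primrec ideal_pow :: "'a graded_ring \<Rightarrow> 'a set \<Rightarrow> nat \<Rightarrow> 'a set" where
  "ideal_pow R I 0 = carrier R"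
| "ideal_pow R I (Suc n) = ideal_prod R I (ideal_pow R I n)"

definition torsion :: "'a graded_ring \<Rightarrow> 'a set \<Rightarrow> ('a, 'b) graded_module \<Rightarrow> 'b set" where
  "torsion R I M = {y \<in> carrier M. \<exists>n. \<forall>a\<in>ideal_pow R I n. a \<odot>\<^bsub>M\<^esub> y = \<zero>\<^bsub>M\<^esub>}"

definition torsion_cocycles ::
    "'a graded_ring \<Rightarrow> 'a set \<Rightarrow> (nat \<Rightarrow> ('a, 'e) graded_module) \<Rightarrow> (nat \<Rightarrow> 'e \<Rightarrow> 'e) \<Rightarrow> nat \<Rightarrow> 'e set"
  where "torsion_cocycles R I E \<delta> i = {z \<in> torsion R I (E i). \<delta> i z = \<zero>\<^bsub>E (Suc i)\<^esub>}"

definition torsion_coboundaries ::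
    "'a graded_ring \<Rightarrow> 'a set \<Rightarrow> (nat \<Rightarrow> ('a, 'e) graded_module) \<Rightarrow> (nat \<Rightarrow> 'e \<Rightarrow> 'e) \<Rightarrow> nat \<Rightarrow> 'e set"
  where "torsion_coboundaries R I E \<delta> i =
    (case i of 0 \<Rightarrow> {\<zero>\<^bsub>E 0\<^esub>} | Suc j \<Rightarrow> \<delta> j ` torsion R I (E j))"

text \<open>The local cohomology modules of \<open>M\<close> with respect to \<open>I\<close> are the right derived functors of
  \<open>I\<close>-torsion at \<open>M\<close>, that is, the cohomology of the \<open>I\<close>-torsion of an injective resolution
  \<open>(E, \<delta>)\<close> of \<open>M\<close>. The resolution, on which the result depends only up to isomorphism, is an
  argument. The fields \<open>mult\<close> and \<open>one\<close> of a module record are irrelevant.\<close>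

definition local_cohomology ::
    "'a graded_ring \<Rightarrow> 'a set \<Rightarrow> (nat \<Rightarrow> ('a, 'e) graded_module) \<Rightarrow> (nat \<Rightarrow> 'e \<Rightarrow> 'e) \<Rightarrow> nat \<Rightarrow>
     ('a, 'e set) graded_module" where
  "local_cohomology R I E \<delta> i =
     (let Z = torsion_cocycles R I E \<delta> i; B = torsion_coboundaries R I E \<delta> i in
      \<lparr>carrier = (\<lambda>z. B +>\<^bsub>E i\<^esub> z) ` Z, monoid.mult = (\<lambda>_ _. B), one = B,
       ring.zero = B, ring.add = set_add (E i),
       smult = (\<lambda>a W. \<Union>z\<in>W. B +>\<^bsub>E i\<^esub> (a \<odot>\<^bsub>E i\<^esub> z)),
       mcomp = (\<lambda>u. (\<lambda>z. B +>\<^bsub>E i\<^esub> z) ` (Z \<inter> mcomp (E i) u))\<rparr>)"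

definition end_degree :: "('a, 'b) graded_module \<Rightarrow> ereal" where
  "end_degree L = Sup {ereal (of_int u) |u. mcomp L u \<noteq> {\<zero>\<^bsub>L\<^esub>}}"

definition krull_dim :: "'a graded_ring \<Rightarrow> enat" where
  "krull_dim R = Sup {enat n |n. \<exists>P :: nat \<Rightarrow> 'a set.
     (\<forall>i\<le>n. primeideal (P i) R) \<and> (\<forall>i<n. P i \<subset> P (Suc i))}"

text \<open>The regularity of any module of which \<open>(E, \<delta>)\<close> is a graded injective resolution. A supremum
  is used since the Krull dimension may be infinite.\<close>

definition regularity ::
    "'a graded_ring \<Rightarrow> (nat \<Rightarrow> ('a, 'e) graded_module) \<Rightarrow> (nat \<Rightarrow> 'e \<Rightarrow> 'e) \<Rightarrow> ereal" where
  "regularity R E \<delta> =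
     Sup {end_degree (local_cohomology R (irrelevant R) E \<delta> i) + ereal (real i) |i.
          enat i \<le> krull_dim R}"

end

theory Submission
  imports Defs
begin

text \<open>Let \<open>p = (0 : y)\<close> be prime and contain \<open>R\<^sub>+\<close>. Then \<open>p\<close> is homogeneous, so it annihilates every
  component \<open>y\<^sub>u\<close> of \<open>y\<close>; as the intersection of the finitely many \<open>(0 : y\<^sub>u)\<close> lies in the prime \<open>p\<close>,
  one of them equals \<open>p\<close>. This \<open>y\<^sub>u\<close> is a nonzero element killed by \<open>R\<^sub>+\<close>, so it gives a nonzero class of
  degree \<open>u\<close> in the zeroth local cohomology, and \<open>v\<^sub>p(M) \<le> u \<le> reg(M)\<close>.

  If the depth is \<open>0\<close>, every element of \<open>R\<^sub>+\<close> is a zero divisor on \<open>M\<close> and hence lies in a maximal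
  annihilator of a nonzero element. These are finitely many associated primes, so prime avoidance
  puts \<open>R\<^sub>+\<close> inside one of them, to which the first part applies.\<close>

section \<open>Sums and direct sums\<close>

lemma (in abelian_monoid) finsum_in_closed_subset:
  assumes "finite A" "\<And>i. i \<in> A \<Longrightarrow> f i \<in> H" "H \<subseteq> carrier G" "\<zero> \<in> H"
    and "\<And>a b. a \<in> H \<Longrightarrow> b \<in> H \<Longrightarrow> a \<oplus> b \<in> H"
  shows "(\<Oplus>i\<in>A. f i) \<in> H"
  using assms(1,2)
proof (induction A rule: finite_induct)
  case empty
  then show ?case using assms(4) by simp
next
  case (insert i A)
  then have "f \<in> A \<rightarrow> carrier G" "f i \<in> carrier G" using assms(3) by auto
  then show ?case using insert assms(5) by simp
qed

lemma internal_direct_sum_subgroup: "internal_direct_sum G A \<Longrightarrow> additive_subgroup (A n) G"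
  unfolding internal_direct_sum_def by (elim conjE allE)

lemma internal_direct_sum_unique_decomp:
  assumes "internal_direct_sum G A" "y \<in> carrier G"
  shows "\<exists>!f. (\<forall>n. f n \<in> A n) \<and> finite {n. f n \<noteq> \<zero>\<^bsub>G\<^esub>} \<and>
    y = (\<Oplus>\<^bsub>G\<^esub>n\<in>{n. f n \<noteq> \<zero>\<^bsub>G\<^esub>}. f n)"
  using assms unfolding internal_direct_sum_def by (elim conjE bspec)

lemma internal_direct_sum_in_carrier:
  "internal_direct_sum G A \<Longrightarrow> y \<in> A n \<Longrightarrow> y \<in> carrier G"
  by (rule subsetD[OF additive_subgroup.a_subset[OF internal_direct_sum_subgroup]])

lemma internal_direct_sum_zero_in: "internal_direct_sum G A \<Longrightarrow> \<zero>\<^bsub>G\<^esub> \<in> A n"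
  by (rule additive_subgroup.zero_closed[OF internal_direct_sum_subgroup])

lemma internal_direct_sum_add:
  "internal_direct_sum G A \<Longrightarrow> y \<in> A n \<Longrightarrow> z \<in> A n \<Longrightarrow> y \<oplus>\<^bsub>G\<^esub> z \<in> A n"
  by (rule additive_subgroup.a_closed[OF internal_direct_sum_subgroup])

lemma internal_direct_sum_decomp:
  assumes "internal_direct_sum G A" "y \<in> carrier G"
  obtains S f where "finite S" "\<And>n. f n \<in> A n" "y = (\<Oplus>\<^bsub>G\<^esub>n\<in>S. f n)"
proof -
  from ex1_implies_ex[OF internal_direct_sum_unique_decomp[OF assms]] obtain f where
    "\<forall>n. f n \<in> A n" "finite {n. f n \<noteq> \<zero>\<^bsub>G\<^esub>}" "y = (\<Oplus>\<^bsub>G\<^esub>n\<in>{n. f n \<noteq> \<zero>\<^bsub>G\<^esub>}. f n)"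
    by (elim exE conjE)
  then show thesis by (intro that[of "{n. f n \<noteq> \<zero>\<^bsub>G\<^esub>}" f]) simp_all
qed

text \<open>Uniqueness of decompositions, applied to zero: extended by zero outside
  \<open>S\<close>, the family \<open>f\<close> decomposes zero, and so does the constant zero
  family, hence they agree.\<close>

lemma internal_direct_sum_zero_imp:
  assumes "abelian_monoid G" "internal_direct_sum G A" "finite S"
    and "\<And>n. n \<in> S \<Longrightarrow> f n \<in> A n" "(\<Oplus>\<^bsub>G\<^esub>n\<in>S. f n) = \<zero>\<^bsub>G\<^esub>" "n \<in> S"
  shows "f n = \<zero>\<^bsub>G\<^esub>"
proof -
  interpret G: abelian_monoid G by fact
  define P where "P h \<longleftrightarrow> (\<forall>n. h n \<in> A n) \<and> finite {n. h n \<noteq> \<zero>\<^bsub>G\<^esub>} \<and>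
    \<zero>\<^bsub>G\<^esub> = (\<Oplus>\<^bsub>G\<^esub>n\<in>{n. h n \<noteq> \<zero>\<^bsub>G\<^esub>}. h n)" for h
  define g where "g n = (if n \<in> S then f n else \<zero>\<^bsub>G\<^esub>)" for n
  have gA: "g n \<in> A n" for n
    using assms(4) internal_direct_sum_zero_in[OF assms(2)] by (simp add: g_def)
  have gc: "g n \<in> carrier G" for n
    using internal_direct_sum_in_carrier[OF assms(2) gA] .
  have sub: "{n. g n \<noteq> \<zero>\<^bsub>G\<^esub>} \<subseteq> S" by (auto simp: g_def)
  have "(\<Oplus>\<^bsub>G\<^esub>n\<in>{n. g n \<noteq> \<zero>\<^bsub>G\<^esub>}. g n) = (\<Oplus>\<^bsub>G\<^esub>n\<in>S. g n)"
    by (rule G.add.finprod_mono_neutral_cong_left) (use sub assms(3) gc in auto)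
  also have "\<dots> = (\<Oplus>\<^bsub>G\<^esub>n\<in>S. f n)"
    by (rule G.finsum_cong')
      (use assms(4) internal_direct_sum_in_carrier[OF assms(2)] in \<open>auto simp: g_def\<close>)
  finally have "\<zero>\<^bsub>G\<^esub> = (\<Oplus>\<^bsub>G\<^esub>n\<in>{n. g n \<noteq> \<zero>\<^bsub>G\<^esub>}. g n)" using assms(5) by simp
  moreover have "finite {n. g n \<noteq> \<zero>\<^bsub>G\<^esub>}" using sub assms(3) finite_subset by blast
  ultimately have g: "P g" using gA unfolding P_def by blast
  have z: "P (\<lambda>_. \<zero>\<^bsub>G\<^esub>)" using internal_direct_sum_zero_in[OF assms(2)] unfolding P_def by simp
  have "\<exists>!h. P h"
    unfolding P_def by (rule internal_direct_sum_unique_decomp[OF assms(2) G.zero_closed])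
  then have "g = (\<lambda>_. \<zero>\<^bsub>G\<^esub>)" using g z by blast
  then show ?thesis using assms(6) unfolding g_def by meson
qed

section \<open>Ideals and prime avoidance\<close>

text \<open>Additive inverses come for free because -a = (-1)a, and commutativity makes one-sided
  absorption enough.\<close>

lemma (in cring) ideal_if_closed:
  assumes "I \<subseteq> carrier R" "\<zero> \<in> I"
    and add: "\<And>a b. a \<in> I \<Longrightarrow> b \<in> I \<Longrightarrow> a \<oplus> b \<in> I"
    and mult: "\<And>a b. a \<in> carrier R \<Longrightarrow> b \<in> I \<Longrightarrow> a \<otimes> b \<in> I"
  shows "ideal I R"
proof (rule idealI[OF ring_axioms])
  have "\<ominus> a \<in> I" if "a \<in> I" for a
  proof -
    have "\<ominus> a = (\<ominus> \<one>) \<otimes> a" using that assms(1) by (auto simp: l_minus)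
    then show ?thesis using mult[of "\<ominus> \<one>" a] that by simp
  qed
  then show "subgroup I (add_monoid R)"
    using assms add by (intro add.subgroupI) (auto simp: a_inv_def)
  show "b \<otimes> a \<in> I" "a \<otimes> b \<in> I" if "a \<in> I" "b \<in> carrier R" for a b
    using mult[OF that(2,1)] m_comm[of a b] that assms(1) by auto
qed

text \<open>Take the product of one element outside the prime from each ideal. The contrapositive is
  what gets used: a prime that contains a finite intersection of ideals contains one of
  them.\<close>

lemma (in primeideal) exists_in_all_ideals_not_in_prime:
  assumes "finite F" "\<And>j. j \<in> F \<Longrightarrow> ideal (J j) R" "\<And>j. j \<in> F \<Longrightarrow> \<not> J j \<subseteq> I"
  shows "\<exists>b\<in>carrier R. b \<notin> I \<and> (\<forall>j\<in>F. b \<in> J j)"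
  using assms
proof (induction F rule: finite_induct)
  case empty
  have "\<one> \<notin> I" using I_notcarr one_imp_carrier by blast
  then show ?case by auto
next
  case (insert i F)
  then obtain b where b: "b \<in> carrier R" "b \<notin> I" "\<forall>j\<in>F. b \<in> J j" by auto
  obtain c where c: "c \<in> J i" "c \<notin> I" using insert.prems(2)[of i] by auto
  have cc: "c \<in> carrier R" using insert.prems(1)[of i] c ideal.Icarr by force
  have "b \<otimes> c \<notin> I" using I_prime b c cc by blast
  moreover have "b \<otimes> c \<in> J j" if "j \<in> insert i F" for j
    using that b c cc insert.prems(1)[of j] ideal.I_l_closed ideal.I_r_closed by (metis insertE)
  ultimately show ?case using b cc by blast
qed

text \<open>Incomparability allows the primes to be added one at a time: if the element
  \<open>a\<close> found for the old primes falls into the new prime \<open>p\<close>, it is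
  corrected by some \<open>b\<close> that lies in \<open>J\<close> and in all old primes but not in
  \<open>p\<close>.\<close>

lemma (in cring) prime_avoidance_incomparable:
  assumes "finite P" "\<And>p. p \<in> P \<Longrightarrow> primeideal p R"
    and "\<And>p q. p \<in> P \<Longrightarrow> q \<in> P \<Longrightarrow> p \<subseteq> q \<Longrightarrow> p = q"
    and "ideal J R" "\<And>p. p \<in> P \<Longrightarrow> \<not> J \<subseteq> p"
  shows "\<exists>a\<in>J. \<forall>p\<in>P. a \<notin> p"
  using assms(1-3,5)
proof (induction P rule: finite_induct)
  case empty
  then show ?case using assms(4) additive_subgroup.zero_closed ideal.axioms(1) by blast
next
  case (insert p P)
  then obtain a where a: "a \<in> J" "\<forall>q\<in>P. a \<notin> q" by (metis insertCI)
  show ?case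
  proof (cases "a \<in> p")
    case False
    then show ?thesis using a by auto
  next
    case True
    interpret p: primeideal p R using insert.prems(1) by simp
    have id: "ideal j R" if "j \<in> insert J P" for j
      using that insert.prems(1) assms(4) primeideal.axioms(1) by auto
    interpret J: ideal J R by fact
    \<comment> \<open>For an old prime \<open>j\<close>, the inclusion would give
      \<open>j = p\<close> by incomparability, although \<open>p\<close> is new.\<close>
    have "\<not> j \<subseteq> p" if "j \<in> insert J P" for j
      using that insert.prems(2)[of j p] insert.prems(3)[of p] insert.hyps(2) by blast
    then obtain b where b: "b \<in> carrier R" "b \<notin> p" "\<forall>j\<in>insert J P. b \<in> j"
      using p.exists_in_all_ideals_not_in_prime[of "insert J P" "\<lambda>j. j"] insert.hyps(1) id by blast
    have c: "a \<in> carrier R" "b \<in> carrier R" using J.Icarr[OF a(1)] b(1) .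
    have "a \<oplus> b \<in> J" using a b by (simp add: J.a_closed)
    moreover have "a \<oplus> b \<notin> p"
    proof
      assume "a \<oplus> b \<in> p"
      then have "\<ominus> a \<oplus> (a \<oplus> b) \<in> p" using True by (simp add: p.a_inv_closed)
      then show False using b c by (simp add: r_neg1)
    qed
    moreover have "a \<oplus> b \<notin> q" if "q \<in> P" for q
    proof
      interpret q: ideal q R using id that by simp
      assume "a \<oplus> b \<in> q"
      then have "(a \<oplus> b) \<oplus> \<ominus> b \<in> q" using b that by (simp add: q.a_inv_closed)
      then show False using a that c by (simp add: a_assoc r_neg)
    qed
    ultimately show ?thesis by auto
  qed
qed

text \<open>By Zorn, since over a Noetherian ring the union of a nonempty chain of ideals is already
  a member of the chain.\<close>

lemma (in noetherian_ring) exists_maximal_ideal_in: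
  assumes "S \<noteq> {}" "\<And>I. I \<in> S \<Longrightarrow> ideal I R"
  shows "\<exists>I\<in>S. \<forall>J\<in>S. I \<subseteq> J \<longrightarrow> J = I"
proof (rule subset_Zorn_nonempty[OF assms(1)])
  fix C assume C: "C \<noteq> {}" "subset.chain S C"
  then have "subset.chain {I. ideal I R} C"
    using assms(2) unfolding subset.chain_def by auto
  then show "\<Union>C \<in> S" using ideal_chain_is_trivial[OF C(1)] C(2) unfolding subset.chain_def by auto
qed

section \<open>The irrelevant ideal\<close>

locale graded_cring = cring R for R :: "'a graded_ring" (structure) +
  assumes direct_sum: "internal_direct_sum R (rcomp R)"
    and rcomp_mult: "\<And>m n a b. a \<in> rcomp R m \<Longrightarrow> b \<in> rcomp R n \<Longrightarrow> a \<otimes> b \<in> rcomp R (m + n)"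
begin

lemma rcomp_carrier: "a \<in> rcomp R n \<Longrightarrow> a \<in> carrier R"
  using internal_direct_sum_in_carrier[OF direct_sum] .

lemma irrelevantI: "(\<And>n. f n \<in> rcomp R n) \<Longrightarrow> (\<Oplus>n\<in>{1..N::nat}. f n) \<in> irrelevant R"
  unfolding irrelevant_def by blast

lemma irrelevant_carrier: "irrelevant R \<subseteq> carrier R"
  unfolding irrelevant_def using rcomp_carrier by (blast intro: finsum_closed)

lemma irrelevant_zero: "\<zero> \<in> irrelevant R"
  using irrelevantI[of "\<lambda>_. \<zero>" 0] internal_direct_sum_zero_in[OF direct_sum] by simp

text \<open>Padding with zeros brings two elements of the irrelevant ideal to a common bound, so
  that they can be added termwise.\<close>

lemma irrelevant_extend:
  assumes "K \<le> N" "\<And>n. f n \<in> rcomp R n"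
  shows "\<exists>g. (\<forall>n. g n \<in> rcomp R n) \<and> (\<Oplus>n\<in>{1..K}. f n) = (\<Oplus>n\<in>{1..N}. g n)"
proof (intro exI conjI allI)
  let ?g = "\<lambda>n. if n \<le> K then f n else \<zero>"
  show "?g n \<in> rcomp R n" for n
    using assms(2) internal_direct_sum_zero_in[OF direct_sum] by auto
  have "f n \<in> carrier R" for n using assms(2) rcomp_carrier by blast
  then show "(\<Oplus>n\<in>{1..K}. f n) = (\<Oplus>n\<in>{1..N}. ?g n)"
    by (intro add.finprod_mono_neutral_cong_left) (use assms(1) in auto)
qed

lemma irrelevant_add:
  assumes "a \<in> irrelevant R" "b \<in> irrelevant R"
  shows "a \<oplus> b \<in> irrelevant R"
proof -
  obtain f K where f: "\<And>n. f n \<in> rcomp R n" "a = (\<Oplus>n\<in>{1..K}. f n)"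
    using assms(1) unfolding irrelevant_def by blast
  obtain g L where g: "\<And>n. g n \<in> rcomp R n" "b = (\<Oplus>n\<in>{1..L}. g n)"
    using assms(2) unfolding irrelevant_def by blast
  obtain f' where f': "\<forall>n. f' n \<in> rcomp R n" "a = (\<Oplus>n\<in>{1..max K L}. f' n)"
    using irrelevant_extend[OF max.cobounded1 f(1)] unfolding f(2) by blast
  obtain g' where g': "\<forall>n. g' n \<in> rcomp R n" "b = (\<Oplus>n\<in>{1..max K L}. g' n)"
    using irrelevant_extend[OF max.cobounded2 g(1)] unfolding g(2) by blast
  have "f' n \<in> carrier R" "g' n \<in> carrier R" for n
    using f'(1) g'(1) rcomp_carrier by blast+
  then have sum: "a \<oplus> b = (\<Oplus>n\<in>{1..max K L}. f' n \<oplus> g' n)"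
    unfolding f'(2) g'(2) by (intro finsum_addf[symmetric]) auto
  have "f' n \<oplus> g' n \<in> rcomp R n" for n
    using internal_direct_sum_add[OF direct_sum] f'(1) g'(1) by blast
  then show ?thesis unfolding sum by (rule irrelevantI)
qed

lemma rcomp_subset_irrelevant:
  assumes "n \<ge> 1" "a \<in> rcomp R n"
  shows "a \<in> irrelevant R"
proof -
  have "(\<Oplus>k\<in>{1..n}. if n = k then a else \<zero>) = a"
    using finsum_singleton[of n "{1..n}" "\<lambda>_. a"] assms rcomp_carrier by auto
  moreover have "(if n = k then a else \<zero>) \<in> rcomp R k" for k
    using assms(2) internal_direct_sum_zero_in[OF direct_sum] by auto
  ultimately show ?thesis
    using irrelevantI[of "\<lambda>k. if n = k then a else \<zero>" n] by simp
qed

text \<open>Expanding both factors into homogeneous parts leaves products of degree k + n with n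
  \<ge> 1, which are again of positive degree.\<close>

lemma irrelevant_ideal: "ideal (irrelevant R) R"
proof (rule ideal_if_closed[OF irrelevant_carrier irrelevant_zero irrelevant_add])
  fix b r assume b: "b \<in> carrier R" and r: "r \<in> irrelevant R"
  obtain S g where g: "finite S" "\<And>n. g n \<in> rcomp R n" "b = (\<Oplus>n\<in>S. g n)"
    using internal_direct_sum_decomp[OF direct_sum b] by blast
  obtain f N where f: "\<And>n. f n \<in> rcomp R n" "r = (\<Oplus>n\<in>{1..N}. f n)"
    using r unfolding irrelevant_def by auto
  have rc: "r \<in> carrier R" using r irrelevant_carrier by blast
  note closed = irrelevant_carrier irrelevant_zero irrelevant_add
  have gr: "g k \<otimes> r \<in> irrelevant R" for k
  proof -
    have gr_sum: "g k \<otimes> r = (\<Oplus>n\<in>{1..N}. g k \<otimes> f n)"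
      unfolding f(2) by (rule finsum_rdistr) (use f g rcomp_carrier in auto)
    show ?thesis
      unfolding gr_sum
    proof (rule finsum_in_closed_subset[OF _ _ closed])
      fix n assume "n \<in> {1..N}"
      then show "g k \<otimes> f n \<in> irrelevant R"
        using rcomp_subset_irrelevant[OF _ rcomp_mult[OF g(2) f(1)], of k n] by simp
    qed auto
  qed
  have br_sum: "b \<otimes> r = (\<Oplus>k\<in>S. g k \<otimes> r)"
    unfolding g(3) by (rule finsum_ldistr) (use g rc rcomp_carrier in auto)
  show "b \<otimes> r \<in> irrelevant R"
    unfolding br_sum by (rule finsum_in_closed_subset[OF g(1) gr closed])
qed

end

section \<open>Annihilators and spans\<close>

lemma (in module) submodule_if_closed:
  assumes "H \<subseteq> carrier M" "\<zero>\<^bsub>M\<^esub> \<in> H"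
    and "\<And>a b. a \<in> H \<Longrightarrow> b \<in> H \<Longrightarrow> a \<oplus>\<^bsub>M\<^esub> b \<in> H"
    and smult: "\<And>a y. a \<in> carrier R \<Longrightarrow> y \<in> H \<Longrightarrow> a \<odot>\<^bsub>M\<^esub> y \<in> H"
  shows "submodule H R M"
proof (rule submoduleI)
  fix y assume "y \<in> H"
  then have "\<ominus>\<^bsub>M\<^esub> y = (\<ominus> \<one>) \<odot>\<^bsub>M\<^esub> y" using assms(1) by (auto simp: smult_l_minus)
  then show "\<ominus>\<^bsub>M\<^esub> y \<in> H" using smult[of "\<ominus> \<one>" y] \<open>y \<in> H\<close> by simp
qed (use assms in auto)

lemma (in module) submodule_zero: "submodule H R M \<Longrightarrow> \<zero>\<^bsub>M\<^esub> \<in> H"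
  using submoduleE(1,2,4)[of H] smult_l_null by (metis R.zero_closed ex_in_conv subsetD)

lemma (in module) zero_submodule: "submodule {\<zero>\<^bsub>M\<^esub>} R M"
  by (rule submodule_if_closed) auto

text \<open>This is the colon ideal (N + W : s). With \<open>W\<close> zero it becomes (N : s), and
  with \<open>N\<close> zero as well the annihilator of \<open>s\<close>; the general case provides
  the coefficients of a generator in the elements of \<open>N\<close>.\<close>

lemma (in module) colon_ideal:
  assumes N: "submodule N R M" and W: "submodule W R M" and s: "s \<in> carrier M"
  shows "ideal {a \<in> carrier R. \<exists>w\<in>W. a \<odot>\<^bsub>M\<^esub> s \<oplus>\<^bsub>M\<^esub> w \<in> N} R"
proof (rule R.ideal_if_closed)
  let ?J = "{a \<in> carrier R. \<exists>w\<in>W. a \<odot>\<^bsub>M\<^esub> s \<oplus>\<^bsub>M\<^esub> w \<in> N}"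
  show "\<zero> \<in> ?J" using submodule_zero[OF N] submodule_zero[OF W] s by force
  have Wc: "w \<in> W \<Longrightarrow> w \<in> carrier M" for w using submoduleE(1)[OF W] by auto
  fix a b assume b: "b \<in> ?J"
  then obtain w where w: "w \<in> W" "b \<odot>\<^bsub>M\<^esub> s \<oplus>\<^bsub>M\<^esub> w \<in> N" and bc: "b \<in> carrier R" by auto
  {
    assume "a \<in> ?J"
    then obtain v where v: "v \<in> W" "a \<odot>\<^bsub>M\<^esub> s \<oplus>\<^bsub>M\<^esub> v \<in> N" and ac: "a \<in> carrier R" by auto
    have "(a \<oplus> b) \<odot>\<^bsub>M\<^esub> s \<oplus>\<^bsub>M\<^esub> (v \<oplus>\<^bsub>M\<^esub> w) = (a \<odot>\<^bsub>M\<^esub> s \<oplus>\<^bsub>M\<^esub> v) \<oplus>\<^bsub>M\<^esub> (b \<odot>\<^bsub>M\<^esub> s \<oplus>\<^bsub>M\<^esub> w)"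
      using ac bc s Wc v w by (simp add: smult_l_distr M.a_ac)
    then have "(a \<oplus> b) \<odot>\<^bsub>M\<^esub> s \<oplus>\<^bsub>M\<^esub> (v \<oplus>\<^bsub>M\<^esub> w) \<in> N"
      using submoduleE(5)[OF N v(2) w(2)] by simp
    then show "a \<oplus> b \<in> ?J" using submoduleE(5)[OF W v(1) w(1)] ac bc by auto
  }
  {
    assume ac: "a \<in> carrier R"
    have "(a \<otimes> b) \<odot>\<^bsub>M\<^esub> s \<oplus>\<^bsub>M\<^esub> a \<odot>\<^bsub>M\<^esub> w = a \<odot>\<^bsub>M\<^esub> (b \<odot>\<^bsub>M\<^esub> s \<oplus>\<^bsub>M\<^esub> w)"
      using ac bc s Wc w by (simp add: smult_assoc1 smult_r_distr)
    then have "(a \<otimes> b) \<odot>\<^bsub>M\<^esub> s \<oplus>\<^bsub>M\<^esub> a \<odot>\<^bsub>M\<^esub> w \<in> N"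
      using submoduleE(4)[OF N ac w(2)] by simp
    then show "a \<otimes> b \<in> ?J" using submoduleE(4)[OF W ac w(1)] ac bc by auto
  }
qed auto

locale module_over_graded_ring = R?: graded_cring R + module R M
  for R :: "'a graded_ring" (structure) and M :: "('a, 'b) graded_module" (structure)
begin

lemma annihilator_ideal:
  assumes "y \<in> carrier M"
  shows "ideal (annihilator R M y) R"
proof -
  have "annihilator R M y = {a \<in> carrier R. \<exists>w\<in>{\<zero>\<^bsub>M\<^esub>}. a \<odot>\<^bsub>M\<^esub> y \<oplus>\<^bsub>M\<^esub> w \<in> {\<zero>\<^bsub>M\<^esub>}}"
    using assms by (auto simp: annihilator_def)
  then show ?thesis using colon_ideal[OF zero_submodule zero_submodule assms] by simp
qed

lemma span_submodule:
  assumes "S \<subseteq> carrier M"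
  shows "submodule (submodule_span R M S) R M"
proof (rule submodule_if_closed)
  show "submodule_span R M S \<subseteq> carrier M"
    using assms carrier_is_submodule unfolding submodule_span_def by auto
qed (auto simp: submodule_span_def submodule_zero submoduleE)

lemma span_superset: "S \<subseteq> submodule_span R M S"
  unfolding submodule_span_def by auto

lemma span_least: "submodule N R M \<Longrightarrow> S \<subseteq> N \<Longrightarrow> submodule_span R M S \<subseteq> N"
  unfolding submodule_span_def by auto

lemma span_mono: "S \<subseteq> T \<Longrightarrow> submodule_span R M S \<subseteq> submodule_span R M T"
  unfolding submodule_span_def by auto

text \<open>The elements in the span of some finite subset of \<open>Y\<close> form a submodule,
  because the union of two finite subsets is finite, and this submodule contains
  \<open>Y\<close>.\<close>

lemma span_finite_subset:
  assumes "Y \<subseteq> carrier M" "y \<in> submodule_span R M Y"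
  shows "\<exists>F. finite F \<and> F \<subseteq> Y \<and> y \<in> submodule_span R M F"
proof -
  let ?U = "{y. \<exists>F. finite F \<and> F \<subseteq> Y \<and> y \<in> submodule_span R M F}"
  have sub: "submodule (submodule_span R M F) R M" if "F \<subseteq> Y" for F
    using span_submodule that assms(1) by blast
  have "submodule ?U R M"
  proof (rule submodule_if_closed)
    show "?U \<subseteq> carrier M" using submoduleE(1)[OF sub] by auto
    show "\<zero>\<^bsub>M\<^esub> \<in> ?U" using submodule_zero[OF sub] by auto
  next
    fix a b assume "a \<in> ?U" "b \<in> ?U"
    then obtain F G where F: "finite F" "F \<subseteq> Y" "a \<in> submodule_span R M F"
      and G: "finite G" "G \<subseteq> Y" "b \<in> submodule_span R M G" by auto
    then have "F \<union> G \<subseteq> Y" "finite (F \<union> G)" by auto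
    moreover have "a \<oplus>\<^bsub>M\<^esub> b \<in> submodule_span R M (F \<union> G)"
      using submoduleE(5)[OF sub] span_mono[of F "F \<union> G"] span_mono[of G "F \<union> G"] F G by blast
    ultimately show "a \<oplus>\<^bsub>M\<^esub> b \<in> ?U" by blast
  next
    fix a y assume "a \<in> carrier R" "y \<in> ?U"
    then show "a \<odot>\<^bsub>M\<^esub> y \<in> ?U" using submoduleE(4)[OF sub] by blast
  qed
  moreover have "Y \<subseteq> ?U"
  proof
    fix y assume "y \<in> Y"
    then show "y \<in> ?U" using span_superset[of "{y}"] by (intro CollectI exI[of _ "{y}"]) auto
  qed
  ultimately show ?thesis using span_least assms(2) by blast
qed

end

section \<open>Finite generation of submodules over a Noetherian ring\<close>

locale module_over_noetherian_graded_ring = module_over_graded_ring + noetherian_ring R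
begin

text \<open>Induction on the generators: the coefficients of \<open>s\<close> in elements of \<open>N\<close>, modulo the span \<open>W\<close> of
  the other generators, form an ideal, and \<open>N \<inter> W\<close> falls under the induction hypothesis.\<close>

lemma submodule_of_span_finitely_generated:
  assumes "finite S" "S \<subseteq> carrier M" "submodule N R M" "N \<subseteq> submodule_span R M S"
  shows "\<exists>T. finite T \<and> T \<subseteq> N \<and> N \<subseteq> submodule_span R M T"
  using assms
proof (induction S arbitrary: N rule: finite_induct)
  case empty
  then show ?case by (intro exI[of _ "{}"]) auto
next
  case (insert s S)
  have s: "s \<in> carrier M" using insert.prems by auto
  define W where "W = submodule_span R M S"
  have W: "submodule W R M" using insert.prems span_submodule unfolding W_def by simp
  note N = insert.prems(2)
  have Wc: "w \<in> W \<Longrightarrow> w \<in> carrier M" for w using submoduleE(1)[OF W] by auto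
  have Nc: "w \<in> N \<Longrightarrow> w \<in> carrier M" for w using submoduleE(1)[OF N] by auto
  obtain A where A: "finite A" "A \<subseteq> carrier R"
    "{a \<in> carrier R. \<exists>w\<in>W. a \<odot>\<^bsub>M\<^esub> s \<oplus>\<^bsub>M\<^esub> w \<in> N} = Idl A"
    using finetely_gen[OF colon_ideal[OF N W s]] by blast
  have "A \<subseteq> Idl A" using A(2) by (rule genideal_self)
  then have "\<forall>a\<in>A. \<exists>w\<in>W. a \<odot>\<^bsub>M\<^esub> s \<oplus>\<^bsub>M\<^esub> w \<in> N" unfolding A(3)[symmetric] by blast
  then obtain h where h: "\<And>a. a \<in> A \<Longrightarrow> h a \<in> W" "\<And>a. a \<in> A \<Longrightarrow> a \<odot>\<^bsub>M\<^esub> s \<oplus>\<^bsub>M\<^esub> h a \<in> N"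
    by metis
  have NW: "submodule (N \<inter> W) R M"
    using submoduleE[OF N] submoduleE[OF W] submodule_zero[OF N] submodule_zero[OF W]
    by (intro submodule_if_closed) auto
  obtain T where T: "finite T" "T \<subseteq> N \<inter> W" "N \<inter> W \<subseteq> submodule_span R M T"
    using insert.IH[OF _ NW] insert.prems unfolding W_def by auto
  \<comment> \<open>The generators of \<open>N\<close>: those of \<open>N \<inter> W\<close>,
    together with one element of \<open>N\<close> for each generator \<open>a\<close> of the
    coefficient ideal, having \<open>a\<close> as its coefficient at \<open>s\<close>.\<close>
  define U where "U = T \<union> (\<lambda>a. a \<odot>\<^bsub>M\<^esub> s \<oplus>\<^bsub>M\<^esub> h a) ` A"
  have UN: "U \<subseteq> N" using T h unfolding U_def by auto
  have U: "submodule (submodule_span R M U) R M" using UN Nc by (intro span_submodule) auto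
  have "A \<subseteq> {a \<in> carrier R. \<exists>w\<in>W. a \<odot>\<^bsub>M\<^esub> s \<oplus>\<^bsub>M\<^esub> w \<in> submodule_span R M U}"
    using A(2) h(1) span_superset[of U] unfolding U_def by blast
  \<comment> \<open>Every coefficient at \<open>s\<close> that occurs in \<open>N\<close> thus
    already occurs in the span of \<open>U\<close>.\<close>
  then have J: "Idl A \<subseteq> {a \<in> carrier R. \<exists>w\<in>W. a \<odot>\<^bsub>M\<^esub> s \<oplus>\<^bsub>M\<^esub> w \<in> submodule_span R M U}"
    by (rule genideal_minimal[OF colon_ideal[OF U W s]])
  let ?V = "{y. \<exists>a\<in>carrier R. \<exists>w\<in>W. y = a \<odot>\<^bsub>M\<^esub> s \<oplus>\<^bsub>M\<^esub> w}"
  have V: "submodule_span R M (insert s S) \<subseteq> ?V"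
  proof (rule span_least)
    show "submodule ?V R M"
    proof (rule submodule_if_closed)
      show "?V \<subseteq> carrier M" using s Wc by auto
      have "\<zero>\<^bsub>M\<^esub> = \<zero> \<odot>\<^bsub>M\<^esub> s \<oplus>\<^bsub>M\<^esub> \<zero>\<^bsub>M\<^esub>" using s by simp
      then show "\<zero>\<^bsub>M\<^esub> \<in> ?V" using submodule_zero[OF W] by blast
    next
      fix y z assume "y \<in> ?V" "z \<in> ?V"
      then obtain a b v w where *: "a \<in> carrier R" "b \<in> carrier R" "v \<in> W" "w \<in> W"
        "y = a \<odot>\<^bsub>M\<^esub> s \<oplus>\<^bsub>M\<^esub> v" "z = b \<odot>\<^bsub>M\<^esub> s \<oplus>\<^bsub>M\<^esub> w" by auto
      then have "y \<oplus>\<^bsub>M\<^esub> z = (a \<oplus> b) \<odot>\<^bsub>M\<^esub> s \<oplus>\<^bsub>M\<^esub> (v \<oplus>\<^bsub>M\<^esub> w)"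
        using s Wc by (simp add: smult_l_distr M.a_ac)
      then show "y \<oplus>\<^bsub>M\<^esub> z \<in> ?V" using * submoduleE(5)[OF W] by blast
    next
      fix c y assume c: "c \<in> carrier R" and "y \<in> ?V"
      then obtain a v where *: "a \<in> carrier R" "v \<in> W" "y = a \<odot>\<^bsub>M\<^esub> s \<oplus>\<^bsub>M\<^esub> v" by auto
      then have "c \<odot>\<^bsub>M\<^esub> y = (c \<otimes> a) \<odot>\<^bsub>M\<^esub> s \<oplus>\<^bsub>M\<^esub> c \<odot>\<^bsub>M\<^esub> v"
        using c s Wc by (simp add: smult_assoc1 smult_r_distr)
      then show "c \<odot>\<^bsub>M\<^esub> y \<in> ?V" using * c submoduleE(4)[OF W] by blast
    qed
    have "s = \<one> \<odot>\<^bsub>M\<^esub> s \<oplus>\<^bsub>M\<^esub> \<zero>\<^bsub>M\<^esub>" using s by simp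
    then have "s \<in> ?V" using submodule_zero[OF W] by blast
    moreover have "y \<in> ?V" if "y \<in> S" for y
    proof -
      have "y \<in> W" using that span_superset unfolding W_def by blast
      moreover from this have "y = \<zero> \<odot>\<^bsub>M\<^esub> s \<oplus>\<^bsub>M\<^esub> y" using s Wc by simp
      ultimately show ?thesis by blast
    qed
    ultimately show "insert s S \<subseteq> ?V" by blast
  qed
  have "N \<subseteq> submodule_span R M U"
  proof
    fix n assume n: "n \<in> N"
    obtain a w where a: "a \<in> carrier R" "w \<in> W" "n = a \<odot>\<^bsub>M\<^esub> s \<oplus>\<^bsub>M\<^esub> w"
      using V n insert.prems(3) by blast
    then have "a \<in> Idl A" using n unfolding A(3)[symmetric] by blast
    then obtain v where v: "v \<in> W" "a \<odot>\<^bsub>M\<^esub> s \<oplus>\<^bsub>M\<^esub> v \<in> submodule_span R M U" using J by blast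
    let ?m = "a \<odot>\<^bsub>M\<^esub> s \<oplus>\<^bsub>M\<^esub> v"
    have mN: "?m \<in> N" using v span_least[OF N UN] by blast
    \<comment> \<open>Both elements have the coefficient \<open>a\<close> at \<open>s\<close>, so
      their difference loses \<open>s\<close> and lands in \<open>N \<inter> W\<close>, which
      \<open>T\<close> spans.\<close>
    have "n \<oplus>\<^bsub>M\<^esub> \<ominus>\<^bsub>M\<^esub> ?m = w \<oplus>\<^bsub>M\<^esub> \<ominus>\<^bsub>M\<^esub> v"
      using a v s Wc by (simp add: M.minus_add M.a_ac M.r_neg M.r_neg1 M.r_neg2)
    then have "n \<oplus>\<^bsub>M\<^esub> \<ominus>\<^bsub>M\<^esub> ?m \<in> N \<inter> W"
      using submoduleE(3,5)[OF N] submoduleE(3,5)[OF W] a v n mN by (metis IntI)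
    then have "n \<oplus>\<^bsub>M\<^esub> \<ominus>\<^bsub>M\<^esub> ?m \<in> submodule_span R M U"
      using T(3) span_mono[of T U] unfolding U_def by blast
    then have "(n \<oplus>\<^bsub>M\<^esub> \<ominus>\<^bsub>M\<^esub> ?m) \<oplus>\<^bsub>M\<^esub> ?m \<in> submodule_span R M U"
      using submoduleE(5)[OF U] v by blast
    then show "n \<in> submodule_span R M U"
      using Nc[OF n] Nc[OF mN] by (simp add: M.a_assoc M.l_neg)
  qed
  moreover have "finite U" using T(1) A(1) unfolding U_def by simp
  ultimately show ?case using UN by (intro exI[of _ U]) simp
qed

text \<open>Finitely many generators of the span of \<open>Y\<close> need not lie in
  \<open>Y\<close>; each of them is replaced by a finite subset of \<open>Y\<close> whose span
  contains it.\<close>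

lemma finite_subset_spanning:
  assumes "finitely_generated R M" "Y \<subseteq> carrier M"
  shows "\<exists>F. finite F \<and> F \<subseteq> Y \<and> Y \<subseteq> submodule_span R M F"
proof -
  obtain S where S: "finite S" "S \<subseteq> carrier M" "submodule_span R M S = carrier M"
    using assms(1) unfolding finitely_generated_def by auto
  have "submodule_span R M Y \<subseteq> carrier M" using submoduleE(1)[OF span_submodule[OF assms(2)]] .
  then obtain T where T: "finite T" "T \<subseteq> submodule_span R M Y"
    "submodule_span R M Y \<subseteq> submodule_span R M T"
    using submodule_of_span_finitely_generated[OF S(1,2) span_submodule[OF assms(2)]] S(3) by auto
  have "\<forall>t\<in>T. \<exists>F. finite F \<and> F \<subseteq> Y \<and> t \<in> submodule_span R M F"
    using span_finite_subset[OF assms(2)] T(2) by blast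
  then obtain F where F: "\<And>t. t \<in> T \<Longrightarrow> finite (F t)" "\<And>t. t \<in> T \<Longrightarrow> F t \<subseteq> Y"
    "\<And>t. t \<in> T \<Longrightarrow> t \<in> submodule_span R M (F t)" by metis
  let ?F = "\<Union>t\<in>T. F t"
  have FY: "?F \<subseteq> Y" using F(2) by blast
  have "t \<in> submodule_span R M ?F" if "t \<in> T" for t
    using F(3)[OF that] span_mono[of "F t" ?F] that by blast
  then have "submodule_span R M T \<subseteq> submodule_span R M ?F"
    using span_least[OF span_submodule[OF subset_trans[OF FY assms(2)]]] by blast
  then have "Y \<subseteq> submodule_span R M ?F" using T(3) span_superset[of Y] by blast
  then show ?thesis using FY T(1) F(1) by (intro exI[of _ ?F]) simp
qed

section \<open>Maximal annihilators and associated primes\<close>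

definition maximal_annihilated :: "'b set" where
  "maximal_annihilated = {y \<in> carrier M. y \<noteq> \<zero>\<^bsub>M\<^esub> \<and>
     (\<forall>z\<in>carrier M. z \<noteq> \<zero>\<^bsub>M\<^esub> \<longrightarrow> annihilator R M y \<subseteq> annihilator R M z \<longrightarrow>
        annihilator R M z = annihilator R M y)}"

lemma exists_maximal_annihilated:
  assumes "y \<in> carrier M" "y \<noteq> \<zero>\<^bsub>M\<^esub>"
  shows "\<exists>z\<in>maximal_annihilated. annihilator R M y \<subseteq> annihilator R M z"
proof -
  let ?S = "{annihilator R M z |z. z \<in> carrier M \<and> z \<noteq> \<zero>\<^bsub>M\<^esub> \<and> annihilator R M y \<subseteq> annihilator R M z}"
  have "\<exists>I\<in>?S. \<forall>J\<in>?S. I \<subseteq> J \<longrightarrow> J = I"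
    by (rule exists_maximal_ideal_in) (use assms annihilator_ideal in auto)
  then obtain z where z: "z \<in> carrier M" "z \<noteq> \<zero>\<^bsub>M\<^esub>" "annihilator R M y \<subseteq> annihilator R M z"
    "\<forall>J\<in>?S. annihilator R M z \<subseteq> J \<longrightarrow> J = annihilator R M z" by blast
  \<comment> \<open>Maximality among the annihilators containing that of \<open>y\<close> is
    maximality among all, since whatever contains the annihilator of \<open>z\<close> also contains
    that of \<open>y\<close>.\<close>
  have "annihilator R M w = annihilator R M z"
    if "w \<in> carrier M" "w \<noteq> \<zero>\<^bsub>M\<^esub>" "annihilator R M z \<subseteq> annihilator R M w" for w
  proof -
    have "annihilator R M w \<in> ?S" using that z(3) by blast
    then show ?thesis using z(4) that(3) by blast
  qed
  then show ?thesis using z unfolding maximal_annihilated_def by blast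
qed

text \<open>If \<open>b\<close> does not kill \<open>y\<close>, the annihilator of by is that of a
  nonzero element and contains that of \<open>y\<close>, so the two agree; and \<open>a\<close>
  kills by as soon as ab kills \<open>y\<close>.\<close>

lemma maximal_annihilated_primeideal:
  assumes "y \<in> maximal_annihilated"
  shows "primeideal (annihilator R M y) R"
proof (rule primeidealI)
  have y: "y \<in> carrier M" "y \<noteq> \<zero>\<^bsub>M\<^esub>" using assms unfolding maximal_annihilated_def by auto
  show "ideal (annihilator R M y) R" using annihilator_ideal y by simp
  show "cring R" by (rule is_cring)
  have "\<one> \<notin> annihilator R M y" using y unfolding annihilator_def by simp
  then show "carrier R \<noteq> annihilator R M y" by blast
  fix a b assume ab: "a \<in> carrier R" "b \<in> carrier R" "a \<otimes> b \<in> annihilator R M y"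
  show "a \<in> annihilator R M y \<or> b \<in> annihilator R M y"
  proof (rule disjCI)
    assume "b \<notin> annihilator R M y"
    then have z: "b \<odot>\<^bsub>M\<^esub> y \<in> carrier M" "b \<odot>\<^bsub>M\<^esub> y \<noteq> \<zero>\<^bsub>M\<^esub>"
      using ab y unfolding annihilator_def by auto
    have "c \<in> annihilator R M (b \<odot>\<^bsub>M\<^esub> y)" if "c \<in> annihilator R M y" for c
    proof -
      have c: "c \<in> carrier R" "c \<odot>\<^bsub>M\<^esub> y = \<zero>\<^bsub>M\<^esub>" using that unfolding annihilator_def by auto
      have "c \<odot>\<^bsub>M\<^esub> (b \<odot>\<^bsub>M\<^esub> y) = b \<odot>\<^bsub>M\<^esub> (c \<odot>\<^bsub>M\<^esub> y)"
        using ab c(1) y m_comm[of b c] by (simp add: smult_assoc1[symmetric])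
      then show ?thesis using c ab unfolding annihilator_def by simp
    qed
    then have "annihilator R M (b \<odot>\<^bsub>M\<^esub> y) = annihilator R M y"
      using assms z unfolding maximal_annihilated_def by blast
    moreover have "a \<in> annihilator R M (b \<odot>\<^bsub>M\<^esub> y)"
      using ab y unfolding annihilator_def by (simp add: smult_assoc1)
    ultimately show "a \<in> annihilator R M y" by simp
  qed
qed

text \<open>Finitely many elements \<open>f\<close> among the \<open>y\<close> with maximal annihilator span all of them. Then the
  intersection of the \<open>(0 : f)\<close> lies in every prime \<open>(0 : y)\<close>, which by maximality is one of them.\<close>

lemma finite_maximal_annihilators:
  assumes "finitely_generated R M"
  shows "finite (annihilator R M ` maximal_annihilated)"
proof -
  have Yc: "maximal_annihilated \<subseteq> carrier M" unfolding maximal_annihilated_def by auto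
  obtain F where F: "finite F" "F \<subseteq> maximal_annihilated"
    "maximal_annihilated \<subseteq> submodule_span R M F"
    using finite_subset_spanning[OF assms Yc] by blast
  have "annihilator R M y \<in> annihilator R M ` F" if y: "y \<in> maximal_annihilated" for y
  proof -
    interpret p: primeideal "annihilator R M y" R using maximal_annihilated_primeideal[OF y] .
    have yc: "y \<in> carrier M" "y \<noteq> \<zero>\<^bsub>M\<^esub>" using y unfolding maximal_annihilated_def by auto
    have "\<exists>f\<in>F. annihilator R M f \<subseteq> annihilator R M y"
    proof (rule ccontr)
      assume "\<not> ?thesis"
      then obtain b where b: "b \<in> carrier R" "b \<notin> annihilator R M y" "\<forall>f\<in>F. b \<in> annihilator R M f"
        using p.exists_in_all_ideals_not_in_prime[OF F(1), of "annihilator R M"]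
          annihilator_ideal F(2) Yc by blast
      \<comment> \<open>The kernel of multiplication by \<open>b\<close> contains \<open>F\<close>,
        hence its span, hence \<open>y\<close>, contrary to the choice of \<open>b\<close>.\<close>
      have "submodule {z \<in> carrier M. b \<odot>\<^bsub>M\<^esub> z = \<zero>\<^bsub>M\<^esub>} R M"
      proof (rule submodule_if_closed)
        fix a z assume "a \<in> carrier R" "z \<in> {z \<in> carrier M. b \<odot>\<^bsub>M\<^esub> z = \<zero>\<^bsub>M\<^esub>}"
        then show "a \<odot>\<^bsub>M\<^esub> z \<in> {z \<in> carrier M. b \<odot>\<^bsub>M\<^esub> z = \<zero>\<^bsub>M\<^esub>}"
          using b(1) m_comm[of a b] smult_assoc1[of a b z] smult_assoc1[of b a z] by auto
      qed (use b(1) in \<open>auto simp: smult_r_distr\<close>)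
      moreover have "F \<subseteq> {z \<in> carrier M. b \<odot>\<^bsub>M\<^esub> z = \<zero>\<^bsub>M\<^esub>}"
        using b(3) F(2) Yc unfolding annihilator_def by blast
      ultimately have "y \<in> {z \<in> carrier M. b \<odot>\<^bsub>M\<^esub> z = \<zero>\<^bsub>M\<^esub>}"
        using span_least F(3) y by blast
      then show False using b unfolding annihilator_def by blast
    qed
    then obtain f where f: "f \<in> F" "annihilator R M f \<subseteq> annihilator R M y" by blast
    then have "annihilator R M y = annihilator R M f"
      using F(2) yc unfolding maximal_annihilated_def by blast
    then show ?thesis using f by blast
  qed
  then show ?thesis using F(1) finite_surj by (metis image_subsetI)
qed

lemma exists_Ass_containing_ideal_of_zero_divisors:
  assumes "finitely_generated R M" "ideal J R"
    and "\<And>a. a \<in> J \<Longrightarrow> \<exists>y\<in>carrier M. y \<noteq> \<zero>\<^bsub>M\<^esub> \<and> a \<odot>\<^bsub>M\<^esub> y = \<zero>\<^bsub>M\<^esub>"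
  shows "\<exists>p\<in>Ass R M. J \<subseteq> p"
proof -
  let ?P = "annihilator R M ` maximal_annihilated"
  have prime: "primeideal p R" if "p \<in> ?P" for p
    using that maximal_annihilated_primeideal by blast
  have "\<exists>p\<in>?P. J \<subseteq> p"
  proof (rule ccontr)
    assume "\<not> ?thesis"
    \<comment> \<open>Maximality makes these primes pairwise incomparable, as prime avoidance
      demands.\<close>
    moreover have "p = q" if "p \<in> ?P" "q \<in> ?P" "p \<subseteq> q" for p q
      using that unfolding maximal_annihilated_def by blast
    ultimately obtain a where a: "a \<in> J" "\<forall>p\<in>?P. a \<notin> p"
      using prime_avoidance_incomparable[OF finite_maximal_annihilators[OF assms(1)] prime _ assms(2)]
      by metis
    obtain y where y: "y \<in> carrier M" "y \<noteq> \<zero>\<^bsub>M\<^esub>" "a \<odot>\<^bsub>M\<^esub> y = \<zero>\<^bsub>M\<^esub>"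
      using assms(3) a(1) by blast
    moreover have "a \<in> carrier R" using a(1) assms(2) ideal.Icarr by metis
    ultimately show False
      using exists_maximal_annihilated[OF y(1,2)] a(2) unfolding annihilator_def by blast
  qed
  then obtain y where "y \<in> maximal_annihilated" "J \<subseteq> annihilator R M y" by blast
  moreover from this have "annihilator R M y \<in> Ass R M"
    using maximal_annihilated_primeideal unfolding Ass_def maximal_annihilated_def by blast
  ultimately show ?thesis by blast
qed

section \<open>Regular sequences\<close>

lemma ideal_smult_submodule:
  assumes "I \<subseteq> carrier R"
  shows "submodule (ideal_smult R M I) R M"
  unfolding ideal_smult_def by (rule span_submodule) (use assms in auto)

lemma ideal_smult_mono: "I \<subseteq> J \<Longrightarrow> ideal_smult R M I \<subseteq> ideal_smult R M J"
  unfolding ideal_smult_def by (rule span_mono) auto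

lemma ideal_smult_empty: "ideal_smult R M {} = {\<zero>\<^bsub>M\<^esub>}"
proof
  show "ideal_smult R M {} \<subseteq> {\<zero>\<^bsub>M\<^esub>}"
    unfolding ideal_smult_def by (rule span_least[OF zero_submodule]) simp
  show "{\<zero>\<^bsub>M\<^esub>} \<subseteq> ideal_smult R M {}"
    using submodule_zero[OF ideal_smult_submodule[of "{}"]] by simp
qed

text \<open>Each term of a regular sequence strictly enlarges the ideal generated by the previous ones.\<close>

lemma exists_maximal_regular_sequence:
  assumes "I \<subseteq> carrier R" "carrier M \<noteq> {\<zero>\<^bsub>M\<^esub>}"
  shows "\<exists>xs. maximal_regular_sequence R M I xs"
proof -
  let ?S = "{Idl (set xs) |xs. set xs \<subseteq> I \<and> regular_sequence R M xs}"
  have "regular_sequence R M []"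
    using assms(2) ideal_smult_empty unfolding regular_sequence_def by auto
  then have "Idl (set []) \<in> ?S" by (intro CollectI exI[of _ "[]"]) auto
  then have "\<exists>J\<in>?S. \<forall>K\<in>?S. J \<subseteq> K \<longrightarrow> K = J"
    by (intro exists_maximal_ideal_in) (use assms(1) genideal_ideal in blast)+
  then obtain xs where xs: "set xs \<subseteq> I" "regular_sequence R M xs"
    and max: "\<forall>K\<in>?S. Idl (set xs) \<subseteq> K \<longrightarrow> K = Idl (set xs)" by blast
  have "\<not> regular_sequence R M (xs @ [a])" if a: "a \<in> I" for a
  proof
    assume reg: "regular_sequence R M (xs @ [a])"
    have c: "set (xs @ [a]) \<subseteq> carrier R" using xs(1) a assms(1) by auto
    have self: "set (xs @ [a]) \<subseteq> Idl (set (xs @ [a]))" using c by (rule genideal_self)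
    have "Idl (set (xs @ [a])) \<in> ?S" using reg xs(1) a by (intro CollectI exI[of _ "xs @ [a]"]) auto
    moreover have "Idl (set xs) \<subseteq> Idl (set (xs @ [a]))"
      using self by (intro genideal_minimal genideal_ideal[OF c]) auto
    ultimately have "Idl (set (xs @ [a])) = Idl (set xs)" using max by blast
    then have aI: "a \<in> Idl (set xs)" using self by auto
    let ?N = "ideal_smult R M (set xs)"
    have N: "submodule ?N R M" using c by (intro ideal_smult_submodule) auto
    \<comment> \<open>As \<open>a\<close> lies in the ideal generated by \<open>xs\<close>, it maps
      all of \<open>M\<close> into \<open>?N\<close>; being a nonzerodivisor modulo
      \<open>?N\<close>, it forces \<open>?N\<close> to be all of \<open>M\<close>, which regularity
      of \<open>xs\<close> excludes.\<close>
    have "y \<in> ?N" if y: "y \<in> carrier M" for y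
    proof -
      let ?K = "{b \<in> carrier R. \<exists>w\<in>{\<zero>\<^bsub>M\<^esub>}. b \<odot>\<^bsub>M\<^esub> y \<oplus>\<^bsub>M\<^esub> w \<in> ?N}"
      have "b \<odot>\<^bsub>M\<^esub> y \<in> ?N" if "b \<in> set xs" for b
        unfolding ideal_smult_def using that y by (intro subsetD[OF span_superset]) blast
      then have "set xs \<subseteq> ?K" using c y by auto
      then have "Idl (set xs) \<subseteq> ?K" by (rule genideal_minimal[OF colon_ideal[OF N zero_submodule y]])
      then have "a \<odot>\<^bsub>M\<^esub> y \<in> ?N" using aI y by auto
      then show ?thesis
        using reg y unfolding regular_sequence_def
        by (auto dest!: spec[of _ "length xs"])
    qed
    then have "?N = carrier M" using submoduleE(1)[OF N] by blast
    then show False using xs(2) unfolding regular_sequence_def by blast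
  qed
  then show ?thesis using xs unfolding maximal_regular_sequence_def by blast
qed

text \<open>Depth zero excludes IM = M, and as maximal regular sequences exist, the chosen one is a
  genuine one, here the empty list. So \<open>[a]\<close> is not regular; since aM lies in IM and is
  therefore proper, only the nonzerodivisor condition can fail.\<close>

lemma zero_divisor_if_depth_0:
  assumes "I \<subseteq> carrier R" "depth R I M = 0" "a \<in> I"
  shows "\<exists>y\<in>carrier M. y \<noteq> \<zero>\<^bsub>M\<^esub> \<and> a \<odot>\<^bsub>M\<^esub> y = \<zero>\<^bsub>M\<^esub>"
proof (rule ccontr)
  assume contr: "\<not> ?thesis"
  have ne: "ideal_smult R M I \<noteq> carrier M"
    and len: "length (SOME xs. maximal_regular_sequence R M I xs) = 0"
    using assms(2) unfolding depth_def by (auto simp: zero_enat_def split: if_splits)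
  have sub: "ideal_smult R M J \<subseteq> carrier M" if "J \<subseteq> carrier R" for J
    using submoduleE(1)[OF ideal_smult_submodule[OF that]] .
  have "carrier M \<noteq> {\<zero>\<^bsub>M\<^esub>}"
    using ne sub[OF assms(1)] submodule_zero[OF ideal_smult_submodule[OF assms(1)]] by auto
  then have "maximal_regular_sequence R M I (SOME xs. maximal_regular_sequence R M I xs)"
    using exists_maximal_regular_sequence[OF assms(1)] someI_ex by metis
  then have "maximal_regular_sequence R M I []" using len by simp
  then have "\<not> regular_sequence R M [a]" using assms(3) unfolding maximal_regular_sequence_def by auto
  moreover have "ideal_smult R M {a} \<noteq> carrier M"
    using ideal_smult_mono[of "{a}" I] assms(3) ne sub[OF assms(1)] by auto
  ultimately show False
    using contr assms(1,3) ideal_smult_empty unfolding regular_sequence_def by auto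
qed

end

section \<open>Homogeneous elements of the zeroth local cohomology\<close>

locale graded_module_over_graded_ring = module_over_graded_ring +
  assumes module_direct_sum: "internal_direct_sum M (mcomp M)"
    and mcomp_smult:
      "\<And>n u a y. a \<in> rcomp R n \<Longrightarrow> y \<in> mcomp M u \<Longrightarrow> a \<odot>\<^bsub>M\<^esub> y \<in> mcomp M (int n + u)"
begin

text \<open>Multiplication by \<open>b\<close> shifts all degrees by \<open>n\<close>, so the
  products stay in distinct components and cannot cancel.\<close>

lemma homogeneous_smult_zero_imp:
  assumes "finite S" "\<And>u. f u \<in> mcomp M u" "b \<in> rcomp R n"
    and "b \<odot>\<^bsub>M\<^esub> (\<Oplus>\<^bsub>M\<^esub>u\<in>S. f u) = \<zero>\<^bsub>M\<^esub>" "u \<in> S"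
  shows "b \<odot>\<^bsub>M\<^esub> f u = \<zero>\<^bsub>M\<^esub>"
proof -
  have b: "b \<in> carrier R" using rcomp_carrier assms(3) .
  have f: "f u \<in> carrier M" for u using internal_direct_sum_in_carrier[OF module_direct_sum assms(2)] .
  \<comment> \<open>The products, reindexed by their own degree k = n + u.\<close>
  let ?g = "\<lambda>k. b \<odot>\<^bsub>M\<^esub> f (k - int n)"
  have "(\<Oplus>\<^bsub>M\<^esub>k\<in>(\<lambda>u. int n + u) ` S. ?g k) = (\<Oplus>\<^bsub>M\<^esub>u\<in>S. ?g (int n + u))"
    by (rule M.add.finprod_reindex) (use b f in \<open>auto simp: inj_on_def\<close>)
  also have "\<dots> = b \<odot>\<^bsub>M\<^esub> (\<Oplus>\<^bsub>M\<^esub>u\<in>S. f u)"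
    using finsum_smult_ldistr[OF assms(1) b, of f] f by simp
  finally have "(\<Oplus>\<^bsub>M\<^esub>k\<in>(\<lambda>u. int n + u) ` S. ?g k) = \<zero>\<^bsub>M\<^esub>" using assms(4) by simp
  then have "?g (int n + u) = \<zero>\<^bsub>M\<^esub>"
  proof (rule internal_direct_sum_zero_imp[OF M.abelian_monoid_axioms module_direct_sum, rotated 2])
    show "?g k \<in> mcomp M k" for k
      using mcomp_smult[OF assms(3) assms(2), of "k - int n"] by simp
  qed (use assms in auto)
  then show ?thesis by simp
qed

lemma Ass_homogeneous_annihilator:
  assumes "p \<in> Ass R M" "irrelevant R \<subseteq> p"
  obtains u y where "y \<in> mcomp M u" "p = annihilator R M y"
proof -
  obtain y where y: "y \<in> carrier M" "p = annihilator R M y" and "primeideal p R"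
    using assms(1) unfolding Ass_def by auto
  interpret p: primeideal p R by fact
  obtain S f where S: "finite S" and f: "\<And>u. f u \<in> mcomp M u" and yf: "y = (\<Oplus>\<^bsub>M\<^esub>u\<in>S. f u)"
    using internal_direct_sum_decomp[OF module_direct_sum y(1)] by blast
  have fc: "f u \<in> carrier M" for u using internal_direct_sum_in_carrier[OF module_direct_sum f] .
  have components: "p \<subseteq> annihilator R M (f u)" if u: "u \<in> S" for u
  proof
    fix a assume a: "a \<in> p"
    obtain T g where T: "finite T" and g: "\<And>n. g n \<in> rcomp R n" and ag: "a = (\<Oplus>n\<in>T. g n)"
      using internal_direct_sum_decomp[OF direct_sum p.Icarr[OF a]] by blast
    have gc: "g n \<in> carrier R" for n using g rcomp_carrier by blast
    have pos: "g n \<in> p" if "n \<noteq> 0" for n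
      using rcomp_subset_irrelevant[OF _ g[of n]] that assms(2) by auto
    \<comment> \<open>Homogeneity of \<open>p\<close>: the parts of positive degree lie in the
      irrelevant ideal, hence in \<open>p\<close>, and the part of degree 0 is what remains of
      \<open>a\<close> after subtracting them.\<close>
    have "g n \<in> p" if n: "n \<in> T" for n
    proof (cases "n = 0")
      case True
      let ?r = "\<Oplus>k\<in>T - {0}. g k"
      have r: "?r \<in> p"
        by (rule R.finsum_in_closed_subset[OF _ _ p.a_subset p.zero_closed p.a_closed])
          (use T pos in auto)
      have "a = g 0 \<oplus> ?r"
        using R.finsum_insert[of "T - {0}" 0 g] T gc n True ag by (simp add: insert_absorb)
      then have "g 0 = a \<oplus> \<ominus> ?r" using gc[of 0] p.Icarr[OF r] by (simp add: R.a_assoc R.r_neg)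
      then show ?thesis using a r True by (simp add: p.a_closed p.a_inv_closed)
    qed (use pos in simp)
    then have "g n \<odot>\<^bsub>M\<^esub> y = \<zero>\<^bsub>M\<^esub>" if "n \<in> T" for n
      using that unfolding y(2) annihilator_def by blast
    then have gA: "g n \<in> annihilator R M (f u)" if "n \<in> T" for n
      using homogeneous_smult_zero_imp[where f = f, OF S f g, of n u] that u gc
      unfolding yf annihilator_def by blast
    interpret A: ideal "annihilator R M (f u)" R using annihilator_ideal[OF fc] .
    show "a \<in> annihilator R M (f u)"
      unfolding ag
      by (rule R.finsum_in_closed_subset[OF T gA A.a_subset A.zero_closed A.a_closed])
  qed
  \<comment> \<open>Otherwise some \<open>b\<close> outside \<open>p\<close> would kill every
    component of \<open>y\<close>, hence \<open>y\<close> itself.\<close>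
  have "\<exists>u\<in>S. annihilator R M (f u) \<subseteq> p"
  proof (rule ccontr)
    assume "\<not> ?thesis"
    then obtain b where b: "b \<in> carrier R" "b \<notin> p" "\<forall>u\<in>S. b \<in> annihilator R M (f u)"
      using p.exists_in_all_ideals_not_in_prime[OF S, of "\<lambda>u. annihilator R M (f u)",
          OF annihilator_ideal[OF fc]] by blast
    have "b \<odot>\<^bsub>M\<^esub> y = (\<Oplus>\<^bsub>M\<^esub>u\<in>S. b \<odot>\<^bsub>M\<^esub> f u)"
      unfolding yf by (rule finsum_smult_ldistr) (use S b fc in auto)
    also have "\<dots> = \<zero>\<^bsub>M\<^esub>"
      by (rule M.add.finprod_one_eqI) (use b(3) in \<open>auto simp: annihilator_def\<close>)
    finally show False using b unfolding y(2) annihilator_def by simp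
  qed
  then show thesis using components f that by blast
qed

text \<open>The augmentation \<open>\<eta>\<close> carries a homogeneous \<open>y\<close> with
  annihilator \<open>p\<close> to a nonzero cocycle of the same degree, which is torsion because the
  irrelevant ideal lies in \<open>p\<close>.\<close>

lemma v_number_at_le_regularity:
  fixes E :: "nat \<Rightarrow> ('a, 'e) graded_module"
  assumes "graded_injective_resolution R M E \<delta> \<eta>" "p \<in> Ass R M" "irrelevant R \<subseteq> p"
  shows "v_number_at R M p \<le> regularity R E \<delta>"
proof -
  let ?I = "irrelevant R"
  obtain u y where y: "y \<in> mcomp M u" "p = annihilator R M y"
    using Ass_homogeneous_annihilator[OF assms(2,3)] .
  have yc: "y \<in> carrier M" using internal_direct_sum_in_carrier[OF module_direct_sum y(1)] .
  interpret p: primeideal p R using assms(2) unfolding Ass_def by auto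
  have y0: "y \<noteq> \<zero>\<^bsub>M\<^esub>" using p.I_notcarr unfolding y(2) annihilator_def by auto
  have "graded_module R (E 0)" and eta: "\<eta> \<in> graded_hom R M (E 0)" and inj: "inj_on \<eta> (carrier M)"
    and im: "\<eta> ` carrier M = {e \<in> carrier (E 0). \<delta> 0 e = \<zero>\<^bsub>E 1\<^esub>}"
    using assms(1) unfolding graded_injective_resolution_def graded_injective_def by auto
  then interpret E: module R "E 0" unfolding graded_module_def by simp
  have eta_smult: "\<eta> (a \<odot>\<^bsub>M\<^esub> z) = a \<odot>\<^bsub>E 0\<^esub> \<eta> z" if "a \<in> carrier R" "z \<in> carrier M" for a z
    using eta that unfolding graded_hom_def by auto
  have ec: "\<eta> y \<in> carrier (E 0)" "\<eta> y \<in> mcomp (E 0) u"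
    using eta yc y(1) unfolding graded_hom_def by auto
  have eta_zero: "\<eta> \<zero>\<^bsub>M\<^esub> = \<zero>\<^bsub>E 0\<^esub>" using eta_smult[of \<zero> y] yc ec by simp
  then have e0: "\<eta> y \<noteq> \<zero>\<^bsub>E 0\<^esub>" using inj_onD[OF inj _ yc, of "\<zero>\<^bsub>M\<^esub>"] y0 by auto
  \<comment> \<open>The first power is by definition the product of \<open>?I\<close> with the whole
    ring; exponent 1 suffices as torsion witness.\<close>
  have "ideal_pow R ?I 1 \<subseteq> ?I"
    using ideal_prod_inter[OF irrelevant_ideal oneideal] by auto
  then have "a \<odot>\<^bsub>E 0\<^esub> \<eta> y = \<zero>\<^bsub>E 0\<^esub>" if "a \<in> ideal_pow R ?I 1" for a
    using that assms(3) eta_smult[of a y] yc eta_zero unfolding y(2) annihilator_def by auto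
  then have "\<eta> y \<in> torsion R ?I (E 0)" using ec unfolding torsion_def by blast
  moreover have "\<delta> 0 (\<eta> y) = \<zero>\<^bsub>E 1\<^esub>" using im yc by blast
  ultimately have cocycle: "\<eta> y \<in> torsion_cocycles R ?I E \<delta> 0" unfolding torsion_cocycles_def by simp
  let ?L = "local_cohomology R ?I E \<delta> 0"
  have "{\<zero>\<^bsub>E 0\<^esub>} +>\<^bsub>E 0\<^esub> \<eta> y \<in> mcomp ?L u"
    using cocycle ec unfolding local_cohomology_def torsion_coboundaries_def Let_def by simp
  \<comment> \<open>In degree 0 the only coboundary is zero, so classes are singletons and a nonzero
    cocycle has a nonzero class.\<close>
  moreover have "{\<zero>\<^bsub>E 0\<^esub>} +>\<^bsub>E 0\<^esub> \<eta> y = {\<eta> y}"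
    using ec unfolding a_r_coset_def' by simp
  moreover have "\<zero>\<^bsub>?L\<^esub> = {\<zero>\<^bsub>E 0\<^esub>}"
    unfolding local_cohomology_def torsion_coboundaries_def Let_def by simp
  ultimately have "mcomp ?L u \<noteq> {\<zero>\<^bsub>?L\<^esub>}" using e0 by auto
  then have "ereal (of_int u) \<le> end_degree ?L"
    unfolding end_degree_def by (intro Sup_upper) blast
  also have "\<dots> = end_degree ?L + ereal (real 0)" by simp
  \<comment> \<open>The index 0 is admissible in the supremum whatever the Krull dimension.\<close>
  also have "\<dots> \<le> regularity R E \<delta>"
    unfolding regularity_def
    by (intro Sup_upper CollectI exI[of _ "0::nat"]) (simp add: zero_enat_def[symmetric])
  finally have "ereal (of_int u) \<le> regularity R E \<delta>" .
  moreover have "v_number_at R M p \<le> ereal (of_int u)"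
    unfolding v_number_at_def using y by (intro Inf_lower) blast
  ultimately show ?thesis by (rule order_trans[rotated])
qed

end

theorem proposition2p2:
  fixes R :: "'a graded_ring" and d :: nat and x :: "nat \<Rightarrow> 'a"
    and M :: "('a, 'b) graded_module"
    and E :: "nat \<Rightarrow> ('a, 'e) graded_module" and \<delta> :: "nat \<Rightarrow> 'e \<Rightarrow> 'e" and \<eta> :: "'b \<Rightarrow> 'e"
  assumes "noetherian_ring R" and "standard_graded R d x"
    and "graded_module R M" and "finitely_generated R M"
    and "graded_injective_resolution R M E \<delta> \<eta>"
  shows "(\<forall>p\<in>Ass R M. irrelevant R \<subseteq> p \<longrightarrow> v_number_at R M p \<le> regularity R E \<delta>) \<and>
         (depth R (irrelevant R) M = 0 \<longrightarrow> v_number R M \<le> regularity R E \<delta>)"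
proof -
  have "graded_ring R" using assms(2) unfolding standard_graded_def by blast
  then interpret graded_cring R
    unfolding graded_ring_def graded_cring_def graded_cring_axioms_def by blast
  interpret module R M using assms(3) unfolding graded_module_def by blast
  interpret noetherian_ring R by fact
  interpret module_over_noetherian_graded_ring R M by unfold_locales
  interpret graded_module_over_graded_ring R M
    using assms(3) unfolding graded_module_def by unfold_locales auto
  have main: "v_number_at R M p \<le> regularity R E \<delta>" if "p \<in> Ass R M" "irrelevant R \<subseteq> p" for p
    using v_number_at_le_regularity[OF assms(5) that] .
  moreover have "v_number R M \<le> regularity R E \<delta>" if depth: "depth R (irrelevant R) M = 0"
  proof -
    obtain p where p: "p \<in> Ass R M" "irrelevant R \<subseteq> p"
      using exists_Ass_containing_ideal_of_zero_divisors[OF assms(4) irrelevant_ideal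
          zero_divisor_if_depth_0[OF irrelevant_carrier depth]] by blast
    have "v_number R M \<le> v_number_at R M p"
      unfolding v_number_def using p(1) by (rule INF_lower)
    then show ?thesis using main[OF p] by (rule order_trans)
  qed
  ultimately show ?thesis by blast
qed

end
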